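(* Let $\{X_i: i\in I\}$ be a family of $T_0$ spaces. Then the following two conditions are equivalent: (1) The product space $\prod_{i\in I}X_i$ is a Rudin space. (2) For each $i\in I$, $X_i$ is a Rudin space.
   Context: For a $T_0$ space $X$, the specialization order is $x\le y$ iff $x\in\overline{\{y\}}$. $\mathsf{K}(X)$ is the set of nonempty compact saturated subsets (saturated = upper set in the specialization order). A family $\mathcal K\subseteq \mathsf K(X)$ is filtered if it is nonempty and for all $K_1,K_2\in\mathcal K$ there is $K_3\in\mathcal K$ with $K_3\subseteq K_1\cap K_2$. A nonempty subset $A$ is irreducible if whenever $A\subseteq F_1\cup F_2$ with $F_1,F_2$ closed, then $A\subseteq F_1$ or $A\subseteq F_2$. A Rudin set is a nonempty closed subset $A$ of $X$ for which there is a filtered family $\mathcal K\subseteq\mathsf K(X)$ such that $A$ is minimal (under inclusion) among the closed subsets of $X$ that meet every member of $\mathcal K$. A $T_0$ space $X$ is a Rudin space if every irreducible closed subset of $X$ is a Rudin set.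
   Formalization: The spaces X_i are assumed nonempty: if one factor is empty, the product is empty and vacuously a Rudin space, while another factor (e.g. an uncountable set with the co-countable topology) need not be one. *)

theory Defs
  imports "HOL-Analysis.Analysis"
begin

definition specialization_le :: "'a topology \<Rightarrow> 'a \<Rightarrow> 'a \<Rightarrow> bool" where
  "specialization_le X x y \<longleftrightarrow> x \<in> topspace X \<and> y \<in> topspace X \<and> x \<in> X closure_of {y}"

definition saturated_in :: "'a topology \<Rightarrow> 'a set \<Rightarrow> bool" where
  "saturated_in X S \<longleftrightarrow>
     S \<subseteq> topspace X \<and> (\<forall>x\<in>S. \<forall>y. specialization_le X x y \<longrightarrow> y \<in> S)"

definition compact_saturated_sets :: "'a topology \<Rightarrow> 'a set set" where
  "compact_saturated_sets X = {K. K \<noteq> {} \<and> compactin X K \<and> saturated_in X K}"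

definition filtered_family :: "'a set set \<Rightarrow> bool" where
  "filtered_family \<K> \<longleftrightarrow>
     \<K> \<noteq> {} \<and> (\<forall>K1\<in>\<K>. \<forall>K2\<in>\<K>. \<exists>K3\<in>\<K>. K3 \<subseteq> K1 \<inter> K2)"

definition irreducible_in :: "'a topology \<Rightarrow> 'a set \<Rightarrow> bool" where
  "irreducible_in X A \<longleftrightarrow>
     A \<subseteq> topspace X \<and> A \<noteq> {} \<and>
     (\<forall>F1 F2. closedin X F1 \<and> closedin X F2 \<and> A \<subseteq> F1 \<union> F2 \<longrightarrow> A \<subseteq> F1 \<or> A \<subseteq> F2)"

definition closed_meeting :: "'a topology \<Rightarrow> 'a set set \<Rightarrow> 'a set \<Rightarrow> bool" where
  "closed_meeting X \<K> A \<longleftrightarrow> closedin X A \<and> (\<forall>K\<in>\<K>. A \<inter> K \<noteq> {})"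

definition rudin_set :: "'a topology \<Rightarrow> 'a set \<Rightarrow> bool" where
  "rudin_set X A \<longleftrightarrow>
     A \<noteq> {} \<and> closedin X A \<and>
     (\<exists>\<K>. \<K> \<subseteq> compact_saturated_sets X \<and> filtered_family \<K> \<and>
          closed_meeting X \<K> A \<and>
          (\<forall>B. closed_meeting X \<K> B \<and> B \<subseteq> A \<longrightarrow> B = A))"

definition rudin_space :: "'a topology \<Rightarrow> bool" where
  "rudin_space X \<longleftrightarrow>
     t0_space X \<and> (\<forall>A. closedin X A \<and> irreducible_in X A \<longrightarrow> rudin_set X A)"

end

theory Submission
  imports Defs
begin

text \<open>
  A Rudin space passes to retracts: for a retraction \<open>r\<close> with section \<open>s\<close>, a family witnessing that
  the closure \<open>C\<close> of \<open>s ` A\<close> is a Rudin set yields the family of all upward closures of \<open>r ` (K \<inter> C)\<close>.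
  Each factor is a retract of the product.

  Conversely, an irreducible closed set \<open>A\<close> of the product is the product of the closures of its
  projections. Choosing a witnessing family for each of these closures, the boxes with sides in these
  families are compact by Tychonoff's theorem. A closed subset of \<open>A\<close> that meets all boxes contains a
  minimal one, which is irreducible by Rudin's lemma, hence is again a product of closed sets, and
  minimality in each coordinate makes it equal to \<open>A\<close>.
\<close>

section \<open>Saturation and irreducibility\<close>

lemma specialization_le_refl:
  assumes "x \<in> topspace X"
  shows "specialization_le X x x"
  using assms by (auto simp: specialization_le_def in_closure_of)

lemma specialization_le_trans:
  assumes "specialization_le X x y" "specialization_le X y z"
  shows "specialization_le X x z"
  using assms by (auto simp: specialization_le_def in_closure_of)

lemma specialization_le_continuous_map:
  assumes "continuous_map X Y f" "specialization_le X x y"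
  shows "specialization_le Y (f x) (f y)"
proof -
  have "f ` (X closure_of {y}) \<subseteq> Y closure_of {f y}"
    using continuous_map_image_closure_subset[OF assms(1), of "{y}"] by simp
  then show ?thesis
    using assms by (auto simp: specialization_le_def continuous_map_def)
qed

lemma closedin_specialization_le:
  assumes "closedin X C" "y \<in> C" "specialization_le X x y"
  shows "x \<in> C"
  using assms closure_of_minimal[of "{y}" C X] by (auto simp: specialization_le_def)

text \<open>This is the saturation of \<open>S\<close>; for \<open>S\<close> inside the space it is
  the intersection of the open sets containing \<open>S\<close>. It turns nonempty compact sets,
  such as continuous images, into members of \<open>compact_saturated_sets\<close>.\<close>

definition up_closure :: "'a topology \<Rightarrow> 'a set \<Rightarrow> 'a set" where
  "up_closure X S = {y. \<exists>x\<in>S. specialization_le X x y}"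

lemma up_closure_superset:
  assumes "S \<subseteq> topspace X"
  shows "S \<subseteq> up_closure X S"
  using assms specialization_le_refl by (fastforce simp: up_closure_def)

lemma saturated_in_up_closure: "saturated_in X (up_closure X S)"
  using specialization_le_trans
  by (fastforce simp: saturated_in_def up_closure_def specialization_le_def)

text \<open>Closed sets are lower sets, so saturating \<open>S\<close> creates no new intersections
  with them. Minimality of closed sets can therefore be tested on the unsaturated sets.\<close>

lemma closedin_meets_up_closure:
  assumes "closedin X C" "C \<inter> up_closure X S \<noteq> {}"
  shows "C \<inter> S \<noteq> {}"
  using assms closedin_specialization_le[OF assms(1)] by (fastforce simp: up_closure_def)

text \<open>Open sets are upper sets, so finitely many of them that cover \<open>S\<close> already
  cover its saturation.\<close>

lemma compactin_up_closure:
  assumes "compactin X S"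
  shows "compactin X (up_closure X S)"
  unfolding compactin_def
proof (intro conjI allI impI)
  show "up_closure X S \<subseteq> topspace X"
    by (auto simp: up_closure_def specialization_le_def)
next
  fix \<U> assume \<U>: "Ball \<U> (openin X) \<and> up_closure X S \<subseteq> \<Union>\<U>"
  then have "S \<subseteq> \<Union>\<U>"
    using up_closure_superset[OF compactin_subset_topspace[OF assms]] by blast
  then obtain \<F> where \<F>: "finite \<F>" "\<F> \<subseteq> \<U>" "S \<subseteq> \<Union>\<F>"
    using assms \<U> unfolding compactin_def by meson
  have "openin X (\<Union>\<F>)"
    using \<F> \<U> by blast
  then have "up_closure X S \<subseteq> \<Union>\<F>"
    using \<F>(3) unfolding up_closure_def specialization_le_def in_closure_of by blast
  with \<F> show "\<exists>\<F>. finite \<F> \<and> \<F> \<subseteq> \<U> \<and> up_closure X S \<subseteq> \<Union>\<F>"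
    by blast
qed

lemma up_closure_in_compact_saturated_sets:
  assumes "compactin X S" "S \<noteq> {}"
  shows "up_closure X S \<in> compact_saturated_sets X"
  using assms up_closure_superset[OF compactin_subset_topspace[OF assms(1)]]
  by (auto simp: compact_saturated_sets_def compactin_up_closure saturated_in_up_closure)

section \<open>Irreducible sets: closures, continuous images, intersections with open sets\<close>

lemma irreducible_in_closure_of:
  assumes "irreducible_in X A"
  shows "irreducible_in X (X closure_of A)"
  unfolding irreducible_in_def
proof (intro conjI allI impI)
  show "X closure_of A \<noteq> {}"
    using assms closure_of_subset[of A X] by (auto simp: irreducible_in_def)
next
  fix F G assume FG: "closedin X F \<and> closedin X G \<and> X closure_of A \<subseteq> F \<union> G"
  then have "A \<subseteq> F \<union> G"
    using assms closure_of_subset[of A X] by (auto simp: irreducible_in_def)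
  then have "A \<subseteq> F \<or> A \<subseteq> G"
    using assms FG by (auto simp: irreducible_in_def)
  then show "X closure_of A \<subseteq> F \<or> X closure_of A \<subseteq> G"
    using FG closure_of_minimal by metis
qed (rule closure_of_subset_topspace)

lemma irreducible_in_continuous_image:
  assumes f: "continuous_map X Y f" and A: "irreducible_in X A"
  shows "irreducible_in Y (f ` A)"
  unfolding irreducible_in_def
proof (intro conjI allI impI)
  show "f ` A \<subseteq> topspace Y" "f ` A \<noteq> {}"
    using A continuous_map_image_subset_topspace[OF f] by (auto simp: irreducible_in_def)
next
  fix F G assume FG: "closedin Y F \<and> closedin Y G \<and> f ` A \<subseteq> F \<union> G"
  let ?p = "\<lambda>C. {x \<in> topspace X. f x \<in> C}"
  have "closedin X (?p F)" "closedin X (?p G)"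
    using closedin_continuous_map_preimage[OF f] FG by auto
  moreover have "A \<subseteq> ?p F \<union> ?p G"
    using FG A by (auto simp: irreducible_in_def)
  ultimately have "A \<subseteq> ?p F \<or> A \<subseteq> ?p G"
    using A unfolding irreducible_in_def by blast
  then show "f ` A \<subseteq> F \<or> f ` A \<subseteq> G"
    by blast
qed

text \<open>Irreducibility read on complements: if \<open>U\<close> and \<open>V\<close> had no
  common point in \<open>A\<close>, their complements would cover \<open>A\<close>, and
  \<open>A\<close> would lie in one of them.\<close>

lemma irreducible_in_Int_open:
  assumes "irreducible_in X A" "openin X U" "openin X V" "A \<inter> U \<noteq> {}" "A \<inter> V \<noteq> {}"
  shows "A \<inter> (U \<inter> V) \<noteq> {}"
proof
  assume "A \<inter> (U \<inter> V) = {}"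
  then have "A \<subseteq> (topspace X - U) \<union> (topspace X - V)"
    using assms(1) by (auto simp: irreducible_in_def)
  then have "A \<subseteq> topspace X - U \<or> A \<subseteq> topspace X - V"
    using assms(1) openin_closedin_eq[of X U] openin_closedin_eq[of X V] assms(2,3)
    unfolding irreducible_in_def by blast
  then show False
    using assms by blast
qed

lemma irreducible_in_INT_open:
  assumes A: "irreducible_in X A" and "finite J"
    and "\<And>j. j \<in> J \<Longrightarrow> openin X (U j)" "\<And>j. j \<in> J \<Longrightarrow> A \<inter> U j \<noteq> {}"
  shows "A \<inter> (\<Inter>j\<in>J. U j) \<noteq> {}"
proof -
  \<comment> \<open>Intersecting with \<open>topspace X\<close> makes the induction start at empty
    \<open>J\<close>, where the bare intersection is \<open>UNIV\<close> and may fail to be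
    open.\<close>
  have "openin X (topspace X \<inter> (\<Inter>j\<in>J. U j)) \<and> A \<inter> (topspace X \<inter> (\<Inter>j\<in>J. U j)) \<noteq> {}"
    using assms(2-)
  proof (induction J rule: finite_induct)
    case empty
    show ?case
      using A by (auto simp: irreducible_in_def)
  next
    case (insert j J)
    define T where "T = topspace X \<inter> (\<Inter>j\<in>J. U j)"
    have "openin X (U j)" "A \<inter> U j \<noteq> {}" "openin X T" "A \<inter> T \<noteq> {}"
      using insert by (auto simp: T_def)
    then have "openin X (U j \<inter> T)" "A \<inter> (U j \<inter> T) \<noteq> {}"
      using irreducible_in_Int_open[OF A] by blast+
    moreover have "topspace X \<inter> (\<Inter>j\<in>insert j J. U j) = U j \<inter> T"
      by (auto simp: T_def)
    ultimately show ?case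
      by simp
  qed
  then show ?thesis
    by blast
qed

section \<open>Rudin's lemma\<close>

text \<open>Zorn's lemma applies because compactness of each \<open>K\<close> lets the intersection
  of a chain of candidates still meet \<open>K\<close>.\<close>

lemma closed_meeting_minimal_exists:
  assumes K: "\<And>K. K \<in> \<K> \<Longrightarrow> compactin X K" and B: "closed_meeting X \<K> B"
  obtains M where "M \<subseteq> B" "closed_meeting X \<K> M"
    "\<And>C. closed_meeting X \<K> C \<Longrightarrow> C \<subseteq> M \<Longrightarrow> C = M"
proof -
  \<comment> \<open>Zorn's lemma is used in its upward form, so the ordered objects are the parts
    \<open>U\<close> removed from \<open>B\<close>: a maximal \<open>U\<close> leaves a minimal
    \<open>B - U\<close>.\<close>
  define \<S> where "\<S> = {U. U \<subseteq> B \<and> closed_meeting X \<K> (B - U)}"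
  have "\<exists>U\<in>\<S>. \<forall>V\<in>\<S>. U \<subseteq> V \<longrightarrow> V = U"
  proof (rule subset_Zorn_nonempty)
    show "\<S> \<noteq> {}"
      using B by (auto simp: \<S>_def intro: exI[of _ "{}"])
  next
    fix \<C> assume \<C>: "\<C> \<noteq> {}" "subset.chain \<S> \<C>"
    let ?D = "(\<lambda>U. B - U) ` \<C>"
    have D: "closed_meeting X \<K> D" if "D \<in> ?D" for D
      using \<C>(2) that by (auto simp: subset.chain_def \<S>_def)
    have eq: "B - \<Union>\<C> = \<Inter>?D"
      using \<C>(1) by blast
    \<comment> \<open>By compactness it is enough that \<open>K\<close> meets the intersection of
      each finite subfamily. For the empty one this says that \<open>K\<close> is nonempty, which
      holds because \<open>B\<close> meets \<open>K\<close>.\<close>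
    have "\<Inter>?D \<inter> K \<noteq> {}" if K0: "K \<in> \<K>" for K
    proof -
      have "K \<inter> \<Inter>\<F> \<noteq> {}" if fin: "finite \<F>" and sub: "\<F> \<subseteq> ?D" for \<F>
      proof (cases "\<F> = {}")
        case True
        then show ?thesis
          using B K0 by (auto simp: closed_meeting_def)
      next
        case False
        \<comment> \<open>A finite nonempty chain contains its own intersection, which is thus a
          single member of \<open>?D\<close> and meets \<open>K\<close>.\<close>
        have "subset.chain UNIV \<F>"
          unfolding subset_chain_def
        proof (intro conjI ballI subset_UNIV)
          fix P Q assume "P \<in> \<F>" "Q \<in> \<F>"
          then obtain V W where "V \<in> \<C>" "W \<in> \<C>" "P = B - V" "Q = B - W"
            using sub by (meson imageE subsetD)
          moreover from this have "V \<subseteq> W \<or> W \<subseteq> V"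
            using \<C>(2) by (simp add: subset_chain_def)
          ultimately show "P \<subseteq> Q \<or> Q \<subseteq> P"
            by blast
        qed
        then have "\<Inter>\<F> \<in> \<F>"
          using Inter_in_chain fin False by blast
        then show ?thesis
          using D[of "\<Inter>\<F>"] sub K0 unfolding closed_meeting_def by blast
      qed
      moreover have "closedin X D" if "D \<in> ?D" for D
        using D[OF that] by (simp add: closed_meeting_def)
      ultimately have "K \<inter> \<Inter>?D \<noteq> {}"
        using K[OF K0, unfolded compactin_fip, THEN conjunct2, THEN spec, of ?D] by presburger
      then show ?thesis
        by blast
    qed
    moreover have "closedin X (\<Inter>?D)"
      using \<C>(1) D by (intro closedin_Inter) (auto simp: closed_meeting_def)
    ultimately have "closed_meeting X \<K> (B - \<Union>\<C>)"
      unfolding eq by (simp add: closed_meeting_def)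
    moreover have "\<Union>\<C> \<subseteq> B"
      using \<C>(2) by (auto simp: subset.chain_def \<S>_def)
    ultimately show "\<Union>\<C> \<in> \<S>"
      by (simp add: \<S>_def)
  qed
  then obtain U where U: "U \<in> \<S>" and max: "\<And>V. V \<in> \<S> \<Longrightarrow> U \<subseteq> V \<Longrightarrow> V = U"
    by blast
  show thesis
  proof (rule that)
    show "B - U \<subseteq> B" "closed_meeting X \<K> (B - U)"
      using U by (auto simp: \<S>_def)
    fix C assume C: "closed_meeting X \<K> C" "C \<subseteq> B - U"
    then have "B - (B - C) = C"
      by blast
    then have "B - C \<in> \<S>"
      using C(1) by (simp add: \<S>_def)
    then have "B - C = U"
      using C(2) U by (intro max) (auto simp: \<S>_def)
    then show "C = B - U"
      using C(2) by blast
  qed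
qed

text \<open>By minimality, a closed part of \<open>M\<close> that meets every member of the family
  is all of \<open>M\<close>. If neither \<open>M \<inter> F\<close> nor \<open>M \<inter> G\<close>
  were such a part, each would miss some member, and a member below both would miss \<open>M\<close>
  altogether.\<close>

lemma closed_meeting_minimal_irreducible:
  assumes \<K>: "\<K> \<subseteq> compact_saturated_sets X" "filtered_family \<K>"
    and M: "closed_meeting X \<K> M" "\<And>C. closed_meeting X \<K> C \<Longrightarrow> C \<subseteq> M \<Longrightarrow> C = M"
  shows "irreducible_in X M"
  unfolding irreducible_in_def
proof (intro conjI allI impI)
  show "M \<subseteq> topspace X"
    using M(1) closedin_subset by (auto simp: closed_meeting_def)
  show "M \<noteq> {}"
    using M(1) \<K>(2) by (auto simp: closed_meeting_def filtered_family_def)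
next
  fix F G assume FG: "closedin X F \<and> closedin X G \<and> M \<subseteq> F \<union> G"
  have "closed_meeting X \<K> (M \<inter> F) \<or> closed_meeting X \<K> (M \<inter> G)"
  proof (rule ccontr)
    assume "\<not> ?thesis"
    then obtain K L where KL: "K \<in> \<K>" "L \<in> \<K>" "M \<inter> F \<inter> K = {}" "M \<inter> G \<inter> L = {}"
      using M(1) FG by (auto simp: closed_meeting_def)
    then obtain N where "N \<in> \<K>" "N \<subseteq> K \<inter> L"
      using \<K>(2) unfolding filtered_family_def by meson
    moreover have "M \<inter> N \<noteq> {}"
      using M(1) \<open>N \<in> \<K>\<close> by (auto simp: closed_meeting_def)
    ultimately show False
      using KL FG by blast
  qed
  then show "M \<subseteq> F \<or> M \<subseteq> G"
    using M(2) by blast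
qed

section \<open>Retracts\<close>

text \<open>Minimality is pulled back along \<open>r\<close>: a competitor \<open>B\<close> inside
  \<open>A\<close> yields the closed part of \<open>C\<close> lying over \<open>B\<close>, which
  must be all of \<open>C\<close>.\<close>

lemma rudin_space_retraction_map_image:
  assumes "retraction_map Y X r" and Y: "rudin_space Y"
  shows "rudin_space X"
  unfolding rudin_space_def
proof (intro conjI allI impI)
  show "t0_space X"
    using assms t0_space_retraction_map_image by (auto simp: rudin_space_def)
next
  fix A assume "closedin X A \<and> irreducible_in X A"
  then have A: "closedin X A" "irreducible_in X A"
    by auto
  obtain s where r: "continuous_map Y X r" and s: "continuous_map X Y s"
    and rs: "\<And>x. x \<in> topspace X \<Longrightarrow> r (s x) = x"
    using assms(1) by (auto simp: retraction_map_def retraction_maps_def)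
  have AX: "A \<subseteq> topspace X"
    using A closedin_subset by blast
  then have rsA: "r ` s ` A = A"
    using rs by force
  \<comment> \<open>The image of \<open>A\<close> under \<open>s\<close> need not be closed. Its
    closure is still irreducible, so the Rudin property of \<open>Y\<close> applies to it.\<close>
  define C where "C = Y closure_of (s ` A)"
  have sC: "s ` A \<subseteq> C"
    unfolding C_def using AX continuous_map_image_subset_topspace[OF s]
    by (intro closure_of_subset) blast
  have rC: "r ` C \<subseteq> A"
    using continuous_map_image_closure_subset[OF r, of "s ` A"] A rsA
    by (simp add: C_def closure_of_closedin)
  have "irreducible_in Y C"
    unfolding C_def using A(2) s by (intro irreducible_in_closure_of irreducible_in_continuous_image)
  then obtain \<K> where \<K>: "\<K> \<subseteq> compact_saturated_sets Y" "filtered_family \<K>"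
      and meet: "closed_meeting Y \<K> C"
      and min: "\<And>B. closed_meeting Y \<K> B \<Longrightarrow> B \<subseteq> C \<Longrightarrow> B = C"
    using Y unfolding rudin_space_def rudin_set_def C_def by (meson closedin_closure_of)
  have C: "closedin Y C"
    by (simp add: C_def)
  \<comment> \<open>Cutting \<open>K\<close> down to \<open>C\<close> before mapping keeps the
    images inside \<open>A\<close>. It also ensures that a closed set meeting \<open>L K\<close>
    contains \<open>r y\<close> for some \<open>y\<close> in both \<open>K\<close> and
    \<open>C\<close>.\<close>
  define L where "L K = up_closure X (r ` (K \<inter> C))" for K
  have sub: "r ` (K \<inter> C) \<subseteq> L K" for K
    unfolding L_def using rC AX by (intro up_closure_superset) blast
  show "rudin_set X A"
    unfolding rudin_set_def
  proof (intro conjI exI allI impI)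
    show "A \<noteq> {}"
      using A(2) by (simp add: irreducible_in_def)
    show "L ` \<K> \<subseteq> compact_saturated_sets X"
    proof clarify
      fix K assume K: "K \<in> \<K>"
      have "compactin Y (K \<inter> C)"
        using K \<K>(1) C by (auto simp: compact_saturated_sets_def compact_Int_closedin)
      moreover have "K \<inter> C \<noteq> {}"
        using meet K by (auto simp: closed_meeting_def)
      ultimately show "L K \<in> compact_saturated_sets X"
        unfolding L_def by (intro up_closure_in_compact_saturated_sets image_compactin[OF _ r]) auto
    qed
    have mono: "K \<subseteq> K' \<Longrightarrow> L K \<subseteq> L K'" for K K'
      by (auto simp: L_def up_closure_def)
    show "filtered_family (L ` \<K>)"
      unfolding filtered_family_def
    proof (intro conjI ballI)
      show "L ` \<K> \<noteq> {}"
        using \<K>(2) by (simp add: filtered_family_def)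
      fix P Q assume "P \<in> L ` \<K>" "Q \<in> L ` \<K>"
      then obtain K K' where K: "K \<in> \<K>" "K' \<in> \<K>" "P = L K" "Q = L K'"
        by blast
      then obtain N where "N \<in> \<K>" "N \<subseteq> K \<inter> K'"
        using \<K>(2) unfolding filtered_family_def by meson
      then show "\<exists>R\<in>L ` \<K>. R \<subseteq> P \<inter> Q"
        using mono K by (metis Int_subset_iff imageI)
    qed
    show "closed_meeting X (L ` \<K>) A"
      unfolding closed_meeting_def
    proof (intro conjI ballI)
      fix P assume "P \<in> L ` \<K>"
      then obtain K where K: "K \<in> \<K>" "P = L K"
        by blast
      then obtain x where "x \<in> C \<inter> K"
        using meet by (auto simp: closed_meeting_def)
      then show "A \<inter> P \<noteq> {}"
        using sub[of K] rC K by blast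
    qed (use A in simp)
  next
    fix B assume B: "closed_meeting X (L ` \<K>) B \<and> B \<subseteq> A"
    then have "closedin X B"
      by (simp add: closed_meeting_def)
    define D where "D = C \<inter> {y \<in> topspace Y. r y \<in> B}"
    have "closed_meeting Y \<K> D"
      unfolding closed_meeting_def
    proof (intro conjI ballI)
      show "closedin Y D"
        unfolding D_def using C closedin_continuous_map_preimage[OF r \<open>closedin X B\<close>] by blast
    next
      fix K assume "K \<in> \<K>"
      then have "B \<inter> L K \<noteq> {}"
        using B by (auto simp: closed_meeting_def)
      then have "B \<inter> r ` (K \<inter> C) \<noteq> {}"
        using closedin_meets_up_closure[OF \<open>closedin X B\<close>] by (simp add: L_def)
      then show "D \<inter> K \<noteq> {}"
        using closedin_subset[OF C] by (auto simp: D_def)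
    qed
    then have "D = C"
      by (rule min) (simp add: D_def)
    \<comment> \<open>All of \<open>C\<close> now lies over \<open>B\<close>, in particular the
      image of \<open>A\<close> under \<open>s\<close>, which \<open>r\<close> maps back onto
      \<open>A\<close>.\<close>
    then have "r ` s ` A \<subseteq> B"
      using sC by (auto simp: D_def)
    then show "B = A"
      using B rsA by auto
  qed (use A in simp)
qed

section \<open>Products\<close>

text \<open>A basic box around a point \<open>x\<close> of the right-hand side restricts finitely
  many coordinates. Each restriction alone is satisfied by a point of \<open>A\<close>, since
  \<open>x i\<close> lies in the closure of the projection; irreducibility then gives one point of
  \<open>A\<close> satisfying all of them. Hence \<open>x\<close> lies in the closure of
  \<open>A\<close>.\<close>

lemma irreducible_closed_in_product_topology:
  assumes A: "closedin (product_topology X I) A" "irreducible_in (product_topology X I) A"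
  shows "A = (\<Pi>\<^sub>E i\<in>I. X i closure_of ((\<lambda>x. x i) ` A))"
proof
  let ?P = "product_topology X I"
  have AP: "A \<subseteq> topspace ?P"
    using A closedin_subset by blast
  show "A \<subseteq> (\<Pi>\<^sub>E i\<in>I. X i closure_of ((\<lambda>x. x i) ` A))"
  proof
    fix x assume x: "x \<in> A"
    have "x i \<in> X i closure_of ((\<lambda>x. x i) ` A)" if "i \<in> I" for i
    proof -
      have "(\<lambda>x. x i) ` A \<subseteq> X i closure_of ((\<lambda>x. x i) ` A)"
        using AP that by (intro closure_of_subset) (auto simp: PiE_iff)
      then show ?thesis
        using x by blast
    qed
    then show "x \<in> (\<Pi>\<^sub>E i\<in>I. X i closure_of ((\<lambda>x. x i) ` A))"
      using x AP by (auto simp: PiE_iff)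
  qed
  show "(\<Pi>\<^sub>E i\<in>I. X i closure_of ((\<lambda>x. x i) ` A)) \<subseteq> A"
  proof
    fix x assume x: "x \<in> (\<Pi>\<^sub>E i\<in>I. X i closure_of ((\<lambda>x. x i) ` A))"
    have "x \<in> ?P closure_of A"
      unfolding in_closure_of
    proof (intro conjI allI impI)
      show "x \<in> topspace ?P"
        using x closure_of_subset_topspace by (fastforce simp: PiE_iff)
    next
      fix T assume T: "x \<in> T \<and> openin ?P T"
      then obtain U where U: "finite {i \<in> I. U i \<noteq> topspace (X i)}"
          "\<And>i. i \<in> I \<Longrightarrow> openin (X i) (U i)" "x \<in> Pi\<^sub>E I U" "Pi\<^sub>E I U \<subseteq> T"
        unfolding openin_product_topology_alt by meson
      let ?J = "{i \<in> I. U i \<noteq> topspace (X i)}"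
      let ?V = "\<lambda>i. {y \<in> topspace ?P. y i \<in> U i}"
      have "A \<inter> (\<Inter>i\<in>?J. ?V i) \<noteq> {}"
      proof (rule irreducible_in_INT_open[OF A(2) U(1)])
        fix i assume "i \<in> ?J"
        then have i: "i \<in> I"
          by simp
        show "openin ?P (?V i)"
          by (rule openin_continuous_map_preimage[OF continuous_map_product_projection[OF i]])
            (rule U(2)[OF i])
        have "x i \<in> X i closure_of ((\<lambda>x. x i) ` A)" "x i \<in> U i"
          using x U(3) i by (auto simp: PiE_iff)
        then obtain a where "a \<in> A" "a i \<in> U i"
          using U(2)[OF i] by (auto simp: in_closure_of)
        then show "A \<inter> ?V i \<noteq> {}"
          using AP by blast
      qed
      then obtain a where a: "a \<in> A" "\<And>i. i \<in> ?J \<Longrightarrow> a i \<in> U i"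
        by blast
      \<comment> \<open>For indices of \<open>I\<close> outside \<open>?J\<close> the side
        \<open>U i\<close> is the whole factor and imposes nothing on \<open>a\<close>.\<close>
      have "a \<in> Pi\<^sub>E I U"
      proof (rule PiE_I)
        fix i assume "i \<in> I"
        then show "a i \<in> U i"
          using a AP by (cases "U i = topspace (X i)") (auto simp: PiE_iff)
      qed (use a(1) AP in \<open>auto simp: PiE_iff extensional_def\<close>)
      then show "\<exists>y. y \<in> A \<and> y \<in> T"
        using a(1) U(4) by blast
    qed
    then show "x \<in> A"
      using A(1) by (simp add: closure_of_closedin)
  qed
qed

text \<open>Compactness is Tychonoff's theorem; saturation holds because projections are continuous
  and so preserve the specialization order.\<close>

lemma PiE_in_compact_saturated_sets:
  assumes "\<And>i. i \<in> I \<Longrightarrow> K i \<in> compact_saturated_sets (X i)"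
  shows "Pi\<^sub>E I K \<in> compact_saturated_sets (product_topology X I)"
proof -
  have K: "K i \<noteq> {}" "compactin (X i) (K i)" "saturated_in (X i) (K i)" if "i \<in> I" for i
    using assms[OF that] by (auto simp: compact_saturated_sets_def)
  have "saturated_in (product_topology X I) (Pi\<^sub>E I K)"
    unfolding saturated_in_def
  proof (intro conjI ballI allI impI)
    show "Pi\<^sub>E I K \<subseteq> topspace (product_topology X I)"
      using K(3) by (simp add: saturated_in_def PiE_mono)
  next
    fix x y assume x: "x \<in> Pi\<^sub>E I K" and xy: "specialization_le (product_topology X I) x y"
    then have "y \<in> topspace (product_topology X I)"
      by (simp add: specialization_le_def)
    moreover have "y i \<in> K i" if "i \<in> I" for i
      using specialization_le_continuous_map[OF continuous_map_product_projection[OF that] xy]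
        K(3)[OF that] x that by (auto simp: saturated_in_def PiE_iff)
    ultimately show "y \<in> Pi\<^sub>E I K"
      by (auto simp: PiE_iff)
  qed
  then show ?thesis
    using K by (simp add: compact_saturated_sets_def PiE_eq_empty_iff compactin_PiE)
qed

text \<open>Lower bounds are chosen in all coordinates at once. The sides range over
  \<open>Pi\<close> because a box depends only on their values on \<open>I\<close>, so choice
  functions need no normalization elsewhere.\<close>

lemma filtered_family_PiE:
  assumes "\<And>i. i \<in> I \<Longrightarrow> filtered_family (\<K> i)"
  shows "filtered_family (Pi\<^sub>E I ` (\<Pi> i\<in>I. \<K> i))"
  unfolding filtered_family_def
proof (intro conjI ballI)
  have "\<exists>K. \<forall>i\<in>I. K i \<in> \<K> i"
    using assms by (intro bchoice) (simp add: filtered_family_def ex_in_conv)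
  then show "Pi\<^sub>E I ` (\<Pi> i\<in>I. \<K> i) \<noteq> {}"
    by auto
next
  fix P Q assume "P \<in> Pi\<^sub>E I ` (\<Pi> i\<in>I. \<K> i)" "Q \<in> Pi\<^sub>E I ` (\<Pi> i\<in>I. \<K> i)"
  then obtain K L where KL: "K \<in> (\<Pi> i\<in>I. \<K> i)" "L \<in> (\<Pi> i\<in>I. \<K> i)" "P = Pi\<^sub>E I K" "Q = Pi\<^sub>E I L"
    by blast
  then have "\<forall>i\<in>I. \<exists>N. N \<in> \<K> i \<and> N \<subseteq> K i \<inter> L i"
    using assms unfolding filtered_family_def by (meson PiE)
  then obtain N where N: "\<And>i. i \<in> I \<Longrightarrow> N i \<in> \<K> i \<and> N i \<subseteq> K i \<inter> L i"
    by metis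
  then have "Pi\<^sub>E I N \<subseteq> P \<inter> Q"
    unfolding KL PiE_Int by (intro PiE_mono) auto
  then show "\<exists>R\<in>Pi\<^sub>E I ` (\<Pi> i\<in>I. \<K> i). R \<subseteq> P \<inter> Q"
    using N by blast
qed

lemma rudin_set_irreducible_closed_product:
  assumes X: "\<And>i. i \<in> I \<Longrightarrow> rudin_space (X i)"
    and A: "closedin (product_topology X I) A" "irreducible_in (product_topology X I) A"
  shows "rudin_set (product_topology X I) A"
proof -
  let ?P = "product_topology X I"
  define Q where "Q B = (\<lambda>i. X i closure_of ((\<lambda>x. x i) ` B))" for B
  have "rudin_set (X i) (Q A i)" if "i \<in> I" for i
    using X[OF that] irreducible_in_closure_of[OF irreducible_in_continuous_image[OF
        continuous_map_product_projection[OF that] A(2)]]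
    by (simp add: rudin_space_def Q_def)
  \<comment> \<open>Bundling the four conditions lets a single application of choice pick a
    witnessing family for every index.\<close>
  moreover define W where "W i \<K> \<longleftrightarrow> \<K> \<subseteq> compact_saturated_sets (X i) \<and> filtered_family \<K> \<and>
      closed_meeting (X i) \<K> (Q A i) \<and>
      (\<forall>B. closed_meeting (X i) \<K> B \<and> B \<subseteq> Q A i \<longrightarrow> B = Q A i)" for i \<K>
  ultimately have "\<forall>i\<in>I. \<exists>\<K>. W i \<K>"
    by (simp add: rudin_set_def)
  then obtain \<K> where "\<And>i. i \<in> I \<Longrightarrow> W i (\<K> i)"
    by metis
  then have \<K>: "\<And>i. i \<in> I \<Longrightarrow> \<K> i \<subseteq> compact_saturated_sets (X i)"
        "\<And>i. i \<in> I \<Longrightarrow> filtered_family (\<K> i)"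
    and meet: "\<And>i. i \<in> I \<Longrightarrow> closed_meeting (X i) (\<K> i) (Q A i)"
    and min: "\<And>i B. i \<in> I \<Longrightarrow> closed_meeting (X i) (\<K> i) B \<Longrightarrow> B \<subseteq> Q A i \<Longrightarrow> B = Q A i"
    by (simp_all add: W_def)
  define \<L> where "\<L> = Pi\<^sub>E I ` (\<Pi> i\<in>I. \<K> i)"
  have \<L>: "\<L> \<subseteq> compact_saturated_sets ?P" "filtered_family \<L>"
    unfolding \<L>_def using \<K> by (auto intro!: PiE_in_compact_saturated_sets filtered_family_PiE)
  have A_eq: "A = Pi\<^sub>E I (Q A)"
    using irreducible_closed_in_product_topology[OF A] unfolding Q_def .
  show ?thesis
    unfolding rudin_set_def
  proof (intro conjI exI allI impI)
    show "A \<noteq> {}"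
      using A(2) by (simp add: irreducible_in_def)
    show "\<L> \<subseteq> compact_saturated_sets ?P" "filtered_family \<L>"
      by fact+
    show "closed_meeting ?P \<L> A"
      unfolding closed_meeting_def
    proof (intro conjI ballI)
      fix L assume "L \<in> \<L>"
      then obtain K where K: "\<And>i. i \<in> I \<Longrightarrow> K i \<in> \<K> i" "L = Pi\<^sub>E I K"
        by (auto simp: \<L>_def)
      then have "Q A i \<inter> K i \<noteq> {}" if "i \<in> I" for i
        using meet[OF that] that by (simp add: closed_meeting_def)
      then have "Pi\<^sub>E I (\<lambda>i. Q A i \<inter> K i) \<noteq> {}"
        by (simp add: PiE_eq_empty_iff)
      then show "A \<inter> L \<noteq> {}"
        using A_eq K(2) by (metis PiE_Int)
    qed (use A in simp)
  next
    fix B assume B: "closed_meeting ?P \<L> B \<and> B \<subseteq> A"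
    have "compactin ?P L" if "L \<in> \<L>" for L
      using \<L>(1) that by (auto simp: compact_saturated_sets_def)
    \<comment> \<open>The set \<open>B\<close> itself need not be a product; a minimal
      \<open>M\<close> inside it is irreducible and hence is one. Since \<open>B\<close> lies
      between \<open>M\<close> and \<open>A\<close>, proving \<open>M = A\<close> suffices.\<close>
    then obtain M where M: "M \<subseteq> B" "closed_meeting ?P \<L> M"
        "\<And>C. closed_meeting ?P \<L> C \<Longrightarrow> C \<subseteq> M \<Longrightarrow> C = M"
      using closed_meeting_minimal_exists[of \<L> ?P B] B by metis
    have "irreducible_in ?P M"
      by (rule closed_meeting_minimal_irreducible[OF \<L> M(2,3)])
    moreover have "closedin ?P M"
      using M(2) by (simp add: closed_meeting_def)
    ultimately have M_eq: "M = Pi\<^sub>E I (Q M)"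
      using irreducible_closed_in_product_topology unfolding Q_def by blast
    have "Q M i = Q A i" if i: "i \<in> I" for i
    proof (rule min[OF i])
      show "Q M i \<subseteq> Q A i"
        unfolding Q_def using M(1) B by (intro closure_of_mono image_mono) auto
      show "closed_meeting (X i) (\<K> i) (Q M i)"
        unfolding closed_meeting_def
      proof (intro conjI ballI)
        show "closedin (X i) (Q M i)"
          by (simp add: Q_def)
      next
        fix K0 assume K0: "K0 \<in> \<K> i"
        \<comment> \<open>To test the one side \<open>K0\<close> in coordinate \<open>i\<close>, the
          other sides may be any members of their families: a point of \<open>M\<close> in the
          resulting box has its coordinate \<open>i\<close> in \<open>K0\<close>.\<close>
        have "\<exists>K. \<forall>i\<in>I. K i \<in> \<K> i"
          using \<K>(2) by (intro bchoice) (simp add: filtered_family_def ex_in_conv)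
        then obtain K where "\<forall>i\<in>I. K i \<in> \<K> i" ..
        then have "Pi\<^sub>E I (K(i := K0)) \<in> \<L>"
          using K0 by (auto simp: \<L>_def)
        then obtain x where "x \<in> M" "x \<in> Pi\<^sub>E I (K(i := K0))"
          using M(2) by (auto simp: closed_meeting_def)
        moreover from this(1) have "x i \<in> Q M i"
          using M_eq i by (metis PiE_mem)
        ultimately show "Q M i \<inter> K0 \<noteq> {}"
          using i by (force dest: PiE_mem)
      qed
    qed
    then have "M = A"
      using M_eq A_eq by (metis PiE_cong)
    then show "B = A"
      using M(1) B by blast
  qed (use A in simp)
qed

theorem theorem4p14:
  fixes I :: "'i set" and X :: "'i \<Rightarrow> 'a topology"
  assumes "\<And>i. i \<in> I \<Longrightarrow> t0_space (X i)"
    and "\<And>i. i \<in> I \<Longrightarrow> topspace (X i) \<noteq> {}"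
  shows "rudin_space (product_topology X I) \<longleftrightarrow> (\<forall>i\<in>I. rudin_space (X i))"
proof
  assume R: "rudin_space (product_topology X I)"
  \<comment> \<open>Nonempty factors give a nonempty product, so each projection is a retraction: a
    section varies one coordinate of a fixed point.\<close>
  have "product_topology X I \<noteq> trivial_topology"
    using assms(2) by (simp add: product_topology_trivial_iff)
  then show "\<forall>i\<in>I. rudin_space (X i)"
    using R rudin_space_retraction_map_image retraction_map_product_projection by metis
next
  assume "\<forall>i\<in>I. rudin_space (X i)"
  moreover have "t0_space (product_topology X I)"
    using assms(1) by (simp add: t0_space_product_topology)
  ultimately show "rudin_space (product_topology X I)"
    using rudin_set_irreducible_closed_product[of I X]
    by (simp add: rudin_space_def[of "product_topology X I"])
qed

end
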